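(* Let $(X,d,\mu)$ be a metric measure space such that $\sup\{\mu(B(x,1)):x\in X\}<\infty$ and $h(r):=\inf\{\mu(B(x,r)):x\in X\}>0$ for all $r\in(0,1)$. Suppose that there exist $s,p,\beta\in\mathcal{P}_b(X)$ and $q\in\mathcal{P}(X)$, satisfying either $s^+<1$ and $q^-<\infty$, or $s^+\le1$ and $q^-=\infty$, such that at least one of the following embeddings is compact: $$M^{s(\cdot)}_{p(\cdot),q(\cdot)}(X,d,\mu)\hookrightarrow L^{\beta(\cdot)}(X,\mu),\qquad N^{s(\cdot)}_{p(\cdot),q(\cdot)}(X,d,\mu)\hookrightarrow L^{\beta(\cdot)}(X,\mu).$$ Then the space $(X,d)$ is totally bounded.
   Context: A metric measure space $(X,d,\mu)$ is a metric space $(X,d)$ with a Borel measure $\mu$ such that $0<\mu(B(x,r))<\infty$ for every open ball $B(x,r)$, $x\in X$, $r\in(0,\infty)$ (in particular $X$ is separable). Exponents: for measurable $p$ on $X$, $p^+=\operatorname{ess\,sup}_X p$, $p^-=\operatorname{ess\,inf}_X p$. $\mathcal{P}(X)$ is the set of measurable $p:X\to(0,\infty]$ with $p^->0$; $\mathcal{P}_b(X)=\mathcal{P}(X)\cap L^\infty(X,\mu)$. Lebesgue spaces: for $p\in\mathcal{P}_b(X)$ let $\rho_{p(\cdot)}(u)=\int_X|u(x)|^{p(x)}\,d\mu(x)$. $L^{p(\cdot)}(X,\mu)$ is the space of measurable $u$ with $\rho_{p(\cdot)}(\lambda u)<\infty$ for some $\lambda>0$, with quasi-norm $\|u\|_{L^{p(\cdot)}}=\inf\{\lambda>0:\rho_{p(\cdot)}(u/\lambda)\le1\}$.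 Mixed spaces ($p\in\mathcal{P}_b(X)$, $q\in\mathcal{P}(X)$): for sequences $\{u_k\}_{k\in\mathbb{Z}}$ of measurable functions, $\|\{u_k\}\|_{L^{p(\cdot)}(\ell^{q(\cdot)})}=\big\|\,\|\{u_k(\cdot)\}_k\|_{\ell^{q(\cdot)}}\big\|_{L^{p(\cdot)}}$ (pointwise $\ell^{q(x)}(\mathbb{Z})$ quasi-norm, supremum if $q(x)=\infty$). Let $\rho_{\ell^{q(\cdot)}(L^{p(\cdot)})}(\{u_k\})=\sum_{k\in\mathbb{Z}}\inf\{\lambda_k>0:\rho_{p(\cdot)}(u_k/\lambda_k^{1/q(\cdot)})\le1\}$ (with $\lambda^{1/\infty}=1$) and $\|\{u_k\}\|_{\ell^{q(\cdot)}(L^{p(\cdot)})}=\inf\{m>0:\rho_{\ell^{q(\cdot)}(L^{p(\cdot)})}(\{u_k\}/m)\le1\}$. Gradients: let $s\in\mathcal{P}_b(X)$ and $u:X\to\overline{\mathbb{R}}$ be measurable and finite a.e. A sequence $\{g_k\}_{k\in\mathbb{Z}}$ of non-negative measurable functions is a vector $s(\cdot)$-gradient of $u$ (written $\{g_k\}\in\mathbb{D}^{s(\cdot)}(u)$) if there is a $\mu$-null set $N_u$ such that $|u(x)-u(y)|\le d(x,y)^{s(x)}g_k(x)+d(x,y)^{s(y)}g_k(y)$ for all $k\in\mathbb{Z}$ and all $x,y\in X\setminus N_u$ with $2^{-k-1}\le d(x,y)<2^{-k}$. Function spaces: $\|u\|_{\dot M^{s(\cdot)}_{p(\cdot),q(\cdot)}}=\inf_{g\in\mathbb{D}^{s(\cdot)}(u)}\|g\|_{L^{p(\cdot)}(\ell^{q(\cdot)})}$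 and $\|u\|_{\dot N^{s(\cdot)}_{p(\cdot),q(\cdot)}}=\inf_{g\in\mathbb{D}^{s(\cdot)}(u)}\|g\|_{\ell^{q(\cdot)}(L^{p(\cdot)})}$. For $A\in\{M,N\}$, $A^{s(\cdot)}_{p(\cdot),q(\cdot)}(X,d,\mu)$ is the space of $u\in L^{p(\cdot)}(X,\mu)$ with $\|u\|_{\dot A^{s(\cdot)}_{p(\cdot),q(\cdot)}}<\infty$, with quasi-norm $\|u\|_{L^{p(\cdot)}}+\|u\|_{\dot A^{s(\cdot)}_{p(\cdot),q(\cdot)}}$. An embedding of $Y$ into $Z$ is compact if $Y\subseteq Z$ with continuous inclusion mapping bounded subsets of $Y$ to totally bounded subsets of $Z$. *)

theory Defs
  imports "HOL-Analysis.Analysis" "HOL-Probability.Essential_Supremum"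
begin

text \<open>The points of \<open>X\<close> are the elements of a type of class \<^class>\<open>metric_space\<close>; measurable means
  Borel measurable.\<close>

definition metric_measure_space :: "'a::metric_space measure \<Rightarrow> bool" where
  "metric_measure_space M \<longleftrightarrow> sets M = sets borel \<and>
     (\<forall>x r. 0 < r \<longrightarrow> 0 < emeasure M (ball x r) \<and> emeasure M (ball x r) < \<infinity>)"

definition essinf :: "'a measure \<Rightarrow> ('a \<Rightarrow> ennreal) \<Rightarrow> ennreal" where
  "essinf M f = Sup {z. AE x in M. z \<le> f x}"

definition exponents :: "'a measure \<Rightarrow> ('a \<Rightarrow> ennreal) set" where
  "exponents M = {p \<in> borel_measurable M. (\<forall>x. 0 < p x) \<and> 0 < essinf M p}"

definition bounded_exponents :: "'a measure \<Rightarrow> ('a \<Rightarrow> ennreal) set" where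
  "bounded_exponents M = {p \<in> exponents M. esssup M p < \<infinity>}"

text \<open>The power \<open>t\<^sup>a\<close> for \<open>t \<in> [0, \<infinity>]\<close> and \<open>a \<in> (0, \<infinity>)\<close>. A bounded exponent may be infinite
  only on a null set, where the value of the power does not matter.\<close>

definition enn_powr :: "ennreal \<Rightarrow> ennreal \<Rightarrow> ennreal" where
  "enn_powr t a = (if t = \<infinity> then \<infinity> else ennreal (enn2real t powr enn2real a))"

text \<open>All functionals below depend on a function only through its absolute value and are
  therefore defined for functions with values in \<open>[0, \<infinity>]\<close>; a function \<open>u\<close> with values in the
  extended real line enters through \<open>abs_fun u\<close>. An infimum over an empty set is \<open>\<infinity>\<close>.\<close>

definition abs_fun :: "('a \<Rightarrow> ereal) \<Rightarrow> 'a \<Rightarrow> ennreal" where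
  "abs_fun u = (\<lambda>x. e2ennreal \<bar>u x\<bar>)"

definition modular :: "'a measure \<Rightarrow> ('a \<Rightarrow> ennreal) \<Rightarrow> ('a \<Rightarrow> ennreal) \<Rightarrow> ennreal" where
  "modular M p f = (\<integral>\<^sup>+ x. enn_powr (f x) (p x) \<partial>M)"

definition Lp_norm :: "'a measure \<Rightarrow> ('a \<Rightarrow> ennreal) \<Rightarrow> ('a \<Rightarrow> ennreal) \<Rightarrow> ennreal" where
  "Lp_norm M p f = (INF l\<in>{l::real. 0 < l \<and> modular M p (\<lambda>x. f x / ennreal l) \<le> 1}. ennreal l)"

definition Lp_space :: "'a measure \<Rightarrow> ('a \<Rightarrow> ennreal) \<Rightarrow> ('a \<Rightarrow> ereal) set" where
  "Lp_space M p = {u \<in> borel_measurable M.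
     \<exists>l::real. 0 < l \<and> modular M p (\<lambda>x. ennreal l * abs_fun u x) < \<infinity>}"

definition lq_norm :: "ennreal \<Rightarrow> (int \<Rightarrow> ennreal) \<Rightarrow> ennreal" where
  "lq_norm q a = (if q = \<infinity> then (SUP k. a k)
     else enn_powr (\<Sum>\<^sub>\<infinity>k\<in>UNIV. enn_powr (a k) q) (inverse q))"

definition Lp_lq_norm ::
  "'a measure \<Rightarrow> ('a \<Rightarrow> ennreal) \<Rightarrow> ('a \<Rightarrow> ennreal) \<Rightarrow> (int \<Rightarrow> 'a \<Rightarrow> ennreal) \<Rightarrow> ennreal" where
  "Lp_lq_norm M p q g = Lp_norm M p (\<lambda>x. lq_norm (q x) (\<lambda>k. g k x))"

text \<open>For \<open>q x = \<infinity>\<close> the exponent \<open>1 / q x\<close> below is \<open>0\<close>, so that \<open>l\<^bsup>1 / q x\<^esup> = 1\<close>.\<close>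

definition lq_Lp_modular ::
  "'a measure \<Rightarrow> ('a \<Rightarrow> ennreal) \<Rightarrow> ('a \<Rightarrow> ennreal) \<Rightarrow> (int \<Rightarrow> 'a \<Rightarrow> ennreal) \<Rightarrow> ennreal" where
  "lq_Lp_modular M p q g = (\<Sum>\<^sub>\<infinity>k\<in>UNIV.
     INF l\<in>{l::real. 0 < l \<and>
              modular M p (\<lambda>x. g k x / ennreal (l powr enn2real (inverse (q x)))) \<le> 1}. ennreal l)"

definition lq_Lp_norm ::
  "'a measure \<Rightarrow> ('a \<Rightarrow> ennreal) \<Rightarrow> ('a \<Rightarrow> ennreal) \<Rightarrow> (int \<Rightarrow> 'a \<Rightarrow> ennreal) \<Rightarrow> ennreal" where
  "lq_Lp_norm M p q g =
     (INF m\<in>{m::real. 0 < m \<and> lq_Lp_modular M p q (\<lambda>k x. g k x / ennreal m) \<le> 1}. ennreal m)"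

text \<open>Used for measurable \<open>u\<close> that are finite almost everywhere. The points where \<open>u\<close> or \<open>s\<close> is
  infinite can be put into the null set \<open>N\<close>, so the conventions for \<open>\<infinity> - \<infinity>\<close> and for the power
  with infinite exponent play no role.\<close>

definition vector_gradients ::
  "'a::metric_space measure \<Rightarrow> ('a \<Rightarrow> ennreal) \<Rightarrow> ('a \<Rightarrow> ereal) \<Rightarrow> (int \<Rightarrow> 'a \<Rightarrow> ennreal) set" where
  "vector_gradients M s u = {g. (\<forall>k. g k \<in> borel_measurable M) \<and>
     (\<exists>N\<in>null_sets M. \<forall>k x y. x \<notin> N \<longrightarrow> y \<notin> N \<longrightarrow>
        2 powi (- k - 1) \<le> dist x y \<longrightarrow> dist x y < 2 powi (- k) \<longrightarrow>
        e2ennreal \<bar>u x - u y\<bar> \<le> ennreal (dist x y powr enn2real (s x)) * g k x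
                              + ennreal (dist x y powr enn2real (s y)) * g k y)}"

definition M_seminorm ::
  "'a::metric_space measure \<Rightarrow> ('a \<Rightarrow> ennreal) \<Rightarrow> ('a \<Rightarrow> ennreal) \<Rightarrow> ('a \<Rightarrow> ennreal)
     \<Rightarrow> ('a \<Rightarrow> ereal) \<Rightarrow> ennreal" where
  "M_seminorm M s p q u = (INF g\<in>vector_gradients M s u. Lp_lq_norm M p q g)"

definition N_seminorm ::
  "'a::metric_space measure \<Rightarrow> ('a \<Rightarrow> ennreal) \<Rightarrow> ('a \<Rightarrow> ennreal) \<Rightarrow> ('a \<Rightarrow> ennreal)
     \<Rightarrow> ('a \<Rightarrow> ereal) \<Rightarrow> ennreal" where
  "N_seminorm M s p q u = (INF g\<in>vector_gradients M s u. lq_Lp_norm M p q g)"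

definition M_space ::
  "'a::metric_space measure \<Rightarrow> ('a \<Rightarrow> ennreal) \<Rightarrow> ('a \<Rightarrow> ennreal) \<Rightarrow> ('a \<Rightarrow> ennreal)
     \<Rightarrow> ('a \<Rightarrow> ereal) set" where
  "M_space M s p q = {u \<in> Lp_space M p. M_seminorm M s p q u < \<infinity>}"

definition N_space ::
  "'a::metric_space measure \<Rightarrow> ('a \<Rightarrow> ennreal) \<Rightarrow> ('a \<Rightarrow> ennreal) \<Rightarrow> ('a \<Rightarrow> ennreal)
     \<Rightarrow> ('a \<Rightarrow> ereal) set" where
  "N_space M s p q = {u \<in> Lp_space M p. N_seminorm M s p q u < \<infinity>}"

definition M_norm ::
  "'a::metric_space measure \<Rightarrow> ('a \<Rightarrow> ennreal) \<Rightarrow> ('a \<Rightarrow> ennreal) \<Rightarrow> ('a \<Rightarrow> ennreal)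
     \<Rightarrow> ('a \<Rightarrow> ereal) \<Rightarrow> ennreal" where
  "M_norm M s p q u = Lp_norm M p (abs_fun u) + M_seminorm M s p q u"

definition N_norm ::
  "'a::metric_space measure \<Rightarrow> ('a \<Rightarrow> ennreal) \<Rightarrow> ('a \<Rightarrow> ennreal) \<Rightarrow> ('a \<Rightarrow> ennreal)
     \<Rightarrow> ('a \<Rightarrow> ereal) \<Rightarrow> ennreal" where
  "N_norm M s p q u = Lp_norm M p (abs_fun u) + N_seminorm M s p q u"

text \<open>Compactness of the inclusion of the function space \<open>Y\<close> with quasi-norm \<open>nY\<close> into the function
  space \<open>Z\<close> with quasi-norm \<open>nZ\<close>. The conjuncts are inclusion, continuity of the inclusion, and
  total boundedness in \<open>Z\<close> of the bounded subsets of \<open>Y\<close>. Functions that agree almost everywhere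
  are at distance \<open>0\<close> and are not identified.\<close>

definition compact_embedding ::
  "('a \<Rightarrow> ereal) set \<Rightarrow> (('a \<Rightarrow> ereal) \<Rightarrow> ennreal)
     \<Rightarrow> ('a \<Rightarrow> ereal) set \<Rightarrow> (('a \<Rightarrow> ereal) \<Rightarrow> ennreal) \<Rightarrow> bool" where
  "compact_embedding Y nY Z nZ \<longleftrightarrow>
     Y \<subseteq> Z \<and>
     (\<forall>u\<in>Y. \<forall>e>0. \<exists>d>0. \<forall>v\<in>Y. nY (\<lambda>x. v x - u x) < d \<longrightarrow> nZ (\<lambda>x. v x - u x) < e) \<and>
     (\<forall>B\<subseteq>Y. (\<exists>C<\<infinity>. \<forall>u\<in>B. nY u \<le> C) \<longrightarrow>
        (\<forall>e>0. \<exists>F\<subseteq>Z. finite F \<and> (\<forall>u\<in>B. \<exists>v\<in>F. nZ (\<lambda>x. u x - v x) < e)))"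

end

theory Submission
  imports Defs
begin

text \<open>
  Fix a radius \<open>0 < r \<le> 1\<close> and attach to every point \<open>c\<close> the tent function
  \<open>bump r c = max 0 (1 - dist c \<cdot> / r)\<close>. The family of all these tents is bounded in both
  \<open>M\<^bsup>s\<^esup>\<^bsub>p,q\<^esub>\<close> and \<open>N\<^bsup>s\<^esup>\<^bsub>p,q\<^esub>\<close>, while two tents whose centres are at distance at least \<open>2 r\<close> are
  separated in \<open>L\<^bsup>\<beta>\<^esup>\<close> by a constant that does not depend on the centres. A compact embedding
  therefore leads to a finite cover of the family by small sets of \<open>L\<^bsup>\<beta>\<^esup>\<close>, and choosing one centre
  for each of these sets yields a finite cover of the space by balls of radius \<open>2 r\<close>.

  Boundedness (\<open>bumps_bounded\<close>). On the annulus \<open>dist x y \<approx> 2\<^sup>-\<^sup>k\<close> a tent varies by at most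
  \<open>min 1 (dist x y / r)\<close>, and it varies only if \<open>x\<close> or \<open>y\<close> lies in the ball \<open>B(c,r)\<close>. Dividing by
  \<open>dist x y powr s(x)\<close> leaves a power \<open>dist x y powr (1 - s(x))\<close> for small distances and
  \<open>dist x y powr - s(x)\<close> for large ones. Hence constants times the indicator of \<open>B(c,r)\<close>, with
  constants comparable to \<open>2 powr - (\<sigma> \<bar>k\<bar>)\<close>, form a vector gradient; here \<open>\<sigma> = min s\<^sub>0 (1 - s\<^sup>+)\<close> for a positive
  lower bound \<open>s\<^sub>0\<close> of \<open>s\<close>. If \<open>s\<^sup>+ < 1\<close> then \<open>\<sigma> > 0\<close> and the \<open>\<ell>\<^sup>q\<close> norms of these weights are bounded
  uniformly in \<open>q\<close> as long as \<open>q\<close> stays away from \<open>0\<close>; if \<open>s\<^sup>+ = 1\<close> the weights are merely bounded,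
  which is enough for \<open>q = \<infinity>\<close>. In either case the mixed norms reduce to the \<open>L\<^sup>p\<close> norm of an indicator of a ball,
  which is controlled by \<open>sup \<mu>(B(x,1)) < \<infinity>\<close>.

  Separation (\<open>measure_le_of_near_common_function\<close>). On \<open>B(c,r/2)\<close> one tent is at least \<open>1/2\<close> and
  the other vanishes, so any third function is at distance at least \<open>1/4\<close> from one of them at every
  point of that ball, whose measure is bounded below by \<open>h(r/2) > 0\<close>.
\<close>

section \<open>Bounds for exponents\<close>

lemma AE_ge_of_less_essinf:
  assumes "z < essinf M f"
  shows "AE x in M. z \<le> f x"
proof -
  obtain y where "z < y" "AE x in M. y \<le> f x"
    using assms unfolding essinf_def less_Sup_iff by auto
  then show ?thesis by (auto elim!: eventually_mono intro: order.trans[OF less_imp_le])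
qed

lemma exponents_positive_lower_bound:
  assumes "p \<in> exponents M"
  obtains a :: real where "0 < a" "AE x in M. ennreal a \<le> p x"
proof -
  have "0 < essinf M p" using assms by (simp add: exponents_def)
  then obtain c where c: "0 < c" "c < essinf M p" using dense by blast
  then obtain a where "0 \<le> a" "c = ennreal a" by (cases c) auto
  with c show ?thesis using that[of a] AE_ge_of_less_essinf by (auto simp: less_le)
qed

lemma bounded_exponents_lower_bound:
  assumes "p \<in> bounded_exponents M"
  obtains a :: real where "0 < a" "AE x in M. a \<le> enn2real (p x)"
proof -
  have p: "p \<in> exponents M" "esssup M p < \<infinity>" using assms by (auto simp: bounded_exponents_def)
  obtain a where a: "0 < a" "AE x in M. ennreal a \<le> p x"
    using exponents_positive_lower_bound[OF p(1)] .
  have "AE x in M. a \<le> enn2real (p x)"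
    using a(2) esssup_AE[of p M]
  proof eventually_elim
    case (elim x)
    then have "p x < \<infinity>" using p(2) by (auto intro: le_less_trans)
    then show ?case using elim(1) a(1) by (cases "p x") auto
  qed
  with a(1) show ?thesis by (rule that)
qed

section \<open>Modulars and Lebesgue norms of functions on a set of small measure\<close>

lemma enn_powr_ennreal [simp]: "0 \<le> t \<Longrightarrow> enn_powr (ennreal t) a = ennreal (t powr enn2real a)"
  by (simp add: enn_powr_def)

lemma enn_powr_0 [simp]: "enn_powr 0 a = 0"
  by (simp add: enn_powr_def)

lemma enn_powr_mono: "s \<le> t \<Longrightarrow> enn_powr s a \<le> enn_powr t a"
  by (cases s; cases t) (auto simp: enn_powr_def powr_mono2 top_unique)

text \<open>For a base \<open>\<delta> \<le> 1\<close> the power \<open>\<delta> powr p x\<close> decreases in the exponent, so a lower bound of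
  \<open>p\<close> alone controls the modular.\<close>

lemma modular_indicator_le:
  assumes f: "AE x in M. f x \<le> ennreal \<delta> * indicator A x"
    and \<delta>: "0 \<le> \<delta>" "\<delta> \<le> 1" and p: "AE x in M. a \<le> enn2real (p x)"
    and A: "A \<in> sets M"
  shows "modular M p f \<le> ennreal (\<delta> powr a) * emeasure M A"
proof -
  have "modular M p f \<le> (\<integral>\<^sup>+ x. ennreal (\<delta> powr a) * indicator A x \<partial>M)"
    unfolding modular_def
  proof (rule nn_integral_mono_AE)
    show "AE x in M. enn_powr (f x) (p x) \<le> ennreal (\<delta> powr a) * indicator A x"
      using f p
    proof eventually_elim
      case (elim x)
      have "enn_powr (f x) (p x) \<le> enn_powr (ennreal \<delta> * indicator A x) (p x)"
        by (rule enn_powr_mono[OF elim(1)])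
      also have "\<dots> \<le> ennreal (\<delta> powr a) * indicator A x"
        using \<delta> elim(2) by (auto simp: indicator_def powr_mono')
      finally show ?case .
    qed
  qed
  then show ?thesis using A by (simp add: nn_integral_cmult_indicator)
qed

text \<open>This scaling factor makes the modular of an indicator at most \<open>1\<close>; it depends on the set only
  through a bound \<open>V\<close> for its measure, hence can be chosen uniformly in the centre of a ball.\<close>

lemma exists_small_power_mult_le_1:
  assumes "V < \<infinity>" "0 < a"
  obtains \<delta> :: real where "0 < \<delta>" "\<delta> \<le> 1" "ennreal (\<delta> powr a) * V \<le> 1"
proof -
  obtain v where v: "0 \<le> v" "V = ennreal v" using assms(1) by (cases V) auto
  define \<delta> where "\<delta> = (1 / (1 + v)) powr (1 / a)"
  have "\<delta> powr a = 1 / (1 + v)" using v assms by (simp add: \<delta>_def powr_powr)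
  then have "ennreal (\<delta> powr a) * V = ennreal (v / (1 + v))"
    using v by (simp add: ennreal_mult[symmetric])
  also have "\<dots> \<le> 1" using v by simp
  finally have "ennreal (\<delta> powr a) * V \<le> 1" .
  moreover have "0 < \<delta>" "\<delta> \<le> 1"
    using v assms(2) by (auto simp: \<delta>_def intro!: powr_le1)
  ultimately show ?thesis using that by blast
qed

lemma Lp_norm_indicator_le:
  assumes f: "AE x in M. f x \<le> ennreal D * indicator A x" and D: "0 < D"
    and \<delta>: "0 < \<delta>" "\<delta> \<le> 1" and p: "AE x in M. a \<le> enn2real (p x)"
    and A: "A \<in> sets M" and small: "ennreal (\<delta> powr a) * emeasure M A \<le> 1"
  shows "Lp_norm M p f \<le> ennreal (D / \<delta>)"
proof -
  have "AE x in M. f x / ennreal (D / \<delta>) \<le> ennreal \<delta> * indicator A x"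
    using f
  proof eventually_elim
    case (elim x)
    have "f x / ennreal (D / \<delta>) \<le> ennreal D * indicator A x / ennreal (D / \<delta>)"
      by (rule divide_right_mono_ennreal[OF elim])
    also have "\<dots> = ennreal \<delta> * indicator A x"
      using D \<delta> by (auto simp: indicator_def divide_ennreal)
    finally show ?case .
  qed
  from order.trans[OF modular_indicator_le[OF this _ \<delta>(2) p A] small]
  have "modular M p (\<lambda>x. f x / ennreal (D / \<delta>)) \<le> 1" using \<delta>(1) by simp
  then show ?thesis
    unfolding Lp_norm_def using D \<delta> by (intro INF_lower) auto
qed

section \<open>Mixed norms of weighted indicators\<close>

text \<open>The disjunction in \<open>sum\<close> treats the two regimes of exponents together: for \<open>q = \<infinity>\<close> the
  bound \<open>w k \<le> 1\<close> suffices, while for finite \<open>q \<ge> b\<close> the power \<open>w k powr q\<close> is dominated by the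
  summable \<open>w k powr b\<close>. Since \<open>T \<ge> 1\<close>, the root \<open>T powr (1 / q)\<close> is at most \<open>T powr (1 / b)\<close>,
  which makes the constant independent of \<open>q\<close> and so of the point where \<open>q\<close> is evaluated.\<close>

lemma lq_norm_le:
  assumes w: "\<And>k. 0 \<le> w k" "\<And>k. w k \<le> 1" and C: "0 \<le> C" and T: "1 \<le> T" and b: "0 < b"
    and q: "ennreal b \<le> q"
    and sum: "q = \<infinity> \<or> (\<Sum>\<^sub>\<infinity>k\<in>UNIV. ennreal (w k powr b)) \<le> ennreal T"
    and a: "\<And>k. a k \<le> ennreal (C * w k)"
  shows "lq_norm q a \<le> ennreal (C * T powr (1 / b))"
proof (cases q)
  case (real c)
  have c: "b \<le> c" using real q by simp
  have "(\<Sum>\<^sub>\<infinity>k. enn_powr (a k) q) \<le> (\<Sum>\<^sub>\<infinity>k. ennreal (C powr c) * ennreal (w k powr b))"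
  proof (rule infsum_mono)
    fix k
    have "enn_powr (a k) q \<le> enn_powr (ennreal (C * w k)) q"
      by (rule enn_powr_mono[OF a])
    also have "\<dots> = ennreal (C powr c) * ennreal (w k powr c)"
      using real C w by (subst enn_powr_ennreal) (simp_all add: powr_mult ennreal_mult)
    also have "\<dots> \<le> ennreal (C powr c) * ennreal (w k powr b)"
      using w c by (intro mult_left_mono ennreal_leI powr_mono') auto
    finally show "enn_powr (a k) q \<le> ennreal (C powr c) * ennreal (w k powr b)" .
  qed (auto intro: nonneg_summable_on_complete)
  also have "\<dots> = ennreal (C powr c) * (\<Sum>\<^sub>\<infinity>k. ennreal (w k powr b))"
    by (simp add: nonneg_infsum_complete sum_distrib_left[symmetric] SUP_mult_left_ennreal)
  also have "\<dots> \<le> ennreal (C powr c) * ennreal T"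
    using sum real by (intro mult_left_mono) auto
  also have "\<dots> = ennreal (C powr c * T)" using T by (simp add: ennreal_mult)
  finally have "enn_powr (\<Sum>\<^sub>\<infinity>k. enn_powr (a k) q) (inverse q)
      \<le> enn_powr (ennreal (C powr c * T)) (inverse q)" by (rule enn_powr_mono)
  also have "\<dots> = ennreal (C * T powr (1 / c))"
  proof -
    have "enn2real (inverse q) = 1 / c"
      using real c b by (simp add: inverse_ennreal inverse_eq_divide)
    then show ?thesis using C T b c by (simp add: powr_mult powr_powr)
  qed
  also have "\<dots> \<le> ennreal (C * T powr (1 / b))"
    using T C b c by (intro ennreal_leI mult_left_mono powr_mono) (auto simp: field_simps)
  finally show ?thesis using real by (simp add: lq_norm_def)
next
  case top
  have "a k \<le> ennreal (C * T powr (1 / b))" for k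
  proof (rule order.trans[OF a ennreal_leI])
    have "C * w k \<le> C * 1" using w C by (intro mult_left_mono) auto
    also have "\<dots> \<le> C * T powr (1 / b)"
      using T C b by (intro mult_left_mono ge_one_powr_ge_zero) auto
    finally show "C * w k \<le> C * T powr (1 / b)" .
  qed
  then show ?thesis using top by (auto simp: lq_norm_def intro: SUP_least)
qed

text \<open>The pointwise \<open>\<ell>\<^sup>q\<close> norm is again a constant multiple of the indicator, which reduces the
  claim to \<open>Lp_norm_indicator_le\<close>.\<close>

lemma Lp_lq_norm_indicator_le:
  assumes w: "\<And>k. 0 \<le> w k" "\<And>k. w k \<le> 1" and C: "0 < C" and T: "1 \<le> T" and b: "0 < b"
    and q: "AE x in M. ennreal b \<le> q x"
    and sum: "(AE x in M. q x = \<infinity>) \<or> (\<Sum>\<^sub>\<infinity>k\<in>UNIV. ennreal (w k powr b)) \<le> ennreal T"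
    and \<delta>: "0 < \<delta>" "\<delta> \<le> 1" and p: "AE x in M. a \<le> enn2real (p x)"
    and A: "A \<in> sets M" and small: "ennreal (\<delta> powr a) * emeasure M A \<le> 1"
  shows "Lp_lq_norm M p q (\<lambda>k x. ennreal (C * w k) * indicator A x)
    \<le> ennreal (C * T powr (1 / b) / \<delta>)"
  unfolding Lp_lq_norm_def
proof (rule Lp_norm_indicator_le[OF _ _ \<delta> p A small])
  have "AE x in M. ennreal b \<le> q x
      \<and> (q x = \<infinity> \<or> (\<Sum>\<^sub>\<infinity>k\<in>UNIV. ennreal (w k powr b)) \<le> ennreal T)"
    using q sum by (auto elim: eventually_elim2)
  then show "AE x in M. lq_norm (q x) (\<lambda>k. ennreal (C * w k) * indicator A x)
      \<le> ennreal (C * T powr (1 / b)) * indicator A x"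
  proof eventually_elim
    case (elim x)
    have "lq_norm (q x) (\<lambda>k. ennreal (C * w k) * indicator A x)
        \<le> ennreal (C * indicator A x * T powr (1 / b))"
      using elim C by (intro lq_norm_le[OF w _ T b]) (auto simp: indicator_def)
    then show ?case by (auto simp: indicator_def split: if_splits)
  qed
qed (use C T in auto)

text \<open>The same constant works for the other order of the norms. In the summable case the admissible
  numbers \<open>\<lambda>\<^sub>k = w k powr b / T\<close> add up to at most \<open>1\<close>; as \<open>\<lambda>\<^sub>k \<le> 1\<close> and \<open>1 / q \<le> 1 / b\<close>, the factor
  \<open>\<lambda>\<^sub>k powr (1 / q)\<close> is at least \<open>w k / T powr (1 / b)\<close> and absorbs the weight \<open>w k\<close>. If \<open>q = \<infinity>\<close>
  almost everywhere, \<open>\<lambda>\<^sub>k\<close> does not enter the modular, every positive number is admissible, and all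
  terms of the sum vanish.\<close>

lemma lq_Lp_norm_indicator_le:
  assumes w: "\<And>k. 0 < w k" "\<And>k. w k \<le> 1" and C: "0 < C" and T: "1 \<le> T" and b: "0 < b"
    and q: "AE x in M. ennreal b \<le> q x"
    and sum: "(AE x in M. q x = \<infinity>) \<or> (\<Sum>\<^sub>\<infinity>k\<in>UNIV. ennreal (w k powr b)) \<le> ennreal T"
    and \<delta>: "0 < \<delta>" "\<delta> \<le> 1" and p: "AE x in M. a \<le> enn2real (p x)"
    and A: "A \<in> sets M" and small: "ennreal (\<delta> powr a) * emeasure M A \<le> 1"
  shows "lq_Lp_norm M p q (\<lambda>k x. ennreal (C * w k) * indicator A x)
    \<le> ennreal (C * T powr (1 / b) / \<delta>)"
proof -
  define m where "m = C * T powr (1 / b) / \<delta>"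
  have m: "0 < m" using C T \<delta> by (simp add: m_def)
  let ?ok = "\<lambda>k l. modular M p (\<lambda>x. ennreal (C * w k) * indicator A x / ennreal m
      / ennreal (l powr enn2real (inverse (q x)))) \<le> 1"
  have okI: "?ok k l" if l: "0 < l" and le: "AE x in M. w k / T powr (1 / b) \<le> l powr enn2real (inverse (q x))" for k l
  proof (rule order.trans[OF modular_indicator_le[OF _ _ \<delta>(2) p A] small])
    show "AE x in M. ennreal (C * w k) * indicator A x / ennreal m
        / ennreal (l powr enn2real (inverse (q x))) \<le> ennreal \<delta> * indicator A x"
      using le
    proof eventually_elim
      case (elim x)
      have "C * w k / m / l powr enn2real (inverse (q x)) \<le> \<delta>"
        using elim C T \<delta> l by (simp add: m_def field_simps)
      then show ?case
        using m C l less_imp_le[OF w(1)] by (auto simp: indicator_def divide_ennreal intro!: ennreal_leI)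
    qed
  qed (use \<delta> in auto)
  have "(\<Sum>\<^sub>\<infinity>k\<in>UNIV. INF l\<in>{l. 0 < l \<and> ?ok k l}. ennreal l) \<le> 1"
    using sum
  proof
    assume inf: "AE x in M. q x = \<infinity>"
    have "(INF l\<in>{l. 0 < l \<and> ?ok k l}. ennreal l) \<le> 0" for k
    proof (rule ennreal_le_epsilon)
      fix e :: real assume e: "0 < e"
      have "1 \<le> T powr (1 / b)" using T b by (intro ge_one_powr_ge_zero) auto
      then have "w k / T powr (1 / b) \<le> 1"
        using w(2)[of k] by (subst divide_le_eq_1_pos) linarith+
      then have "?ok k e"
        using inf e by (intro okI) (auto elim!: eventually_mono)
      then show "(INF l\<in>{l. 0 < l \<and> ?ok k l}. ennreal l) \<le> 0 + ennreal e"
        using e by (auto intro: INF_lower)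
    qed
    then show ?thesis by simp
  next
    assume sum: "(\<Sum>\<^sub>\<infinity>k\<in>UNIV. ennreal (w k powr b)) \<le> ennreal T"
    have "(INF l\<in>{l. 0 < l \<and> ?ok k l}. ennreal l) \<le> ennreal (1 / T) * ennreal (w k powr b)" for k
    proof -
      define l where "l = w k powr b / T"
      have l: "0 < l" "l \<le> 1" "l powr (1 / b) = w k / T powr (1 / b)"
        using w[of k] T b powr_le1[of b "w k"]
        by (auto simp: l_def powr_divide powr_powr field_simps)
      have "?ok k l"
      proof (rule okI[OF l(1)])
        show "AE x in M. w k / T powr (1 / b) \<le> l powr enn2real (inverse (q x))"
          using q
        proof eventually_elim
          case (elim x)
          have "enn2real (inverse (q x)) \<le> 1 / b"
            using elim b by (cases "q x") (auto simp: inverse_ennreal field_simps)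
          then show ?case using l by (metis less_imp_le powr_mono')
        qed
      qed
      then have "(INF l\<in>{l. 0 < l \<and> ?ok k l}. ennreal l) \<le> ennreal l"
        using l by (intro INF_lower) auto
      also have "\<dots> = ennreal (1 / T) * ennreal (w k powr b)"
        using T by (simp add: l_def ennreal_mult[symmetric])
      finally show ?thesis .
    qed
    then have "(\<Sum>\<^sub>\<infinity>k\<in>UNIV. INF l\<in>{l. 0 < l \<and> ?ok k l}. ennreal l)
        \<le> (\<Sum>\<^sub>\<infinity>k. ennreal (1 / T) * ennreal (w k powr b))"
      by (intro infsum_mono nonneg_summable_on_complete) auto
    also have "\<dots> = ennreal (1 / T) * (\<Sum>\<^sub>\<infinity>k. ennreal (w k powr b))"
      by (simp add: nonneg_infsum_complete sum_distrib_left[symmetric] SUP_mult_left_ennreal)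
    also have "\<dots> \<le> ennreal (1 / T) * ennreal T"
      using sum by (intro mult_left_mono) auto
    also have "\<dots> = 1" using T by (simp add: ennreal_mult[symmetric])
    finally show ?thesis .
  qed
  then show ?thesis
    unfolding lq_Lp_norm_def using m
    by (intro INF_lower) (auto simp: m_def[symmetric] lq_Lp_modular_def)
qed

lemma two_sided_geometric_sum_finite:
  assumes "0 < c"
  obtains T :: real where "1 \<le> T" "(\<Sum>\<^sub>\<infinity>k\<in>UNIV. ennreal (2 powr - (c * \<bar>real_of_int k\<bar>))) \<le> ennreal T"
proof -
  define t where "t = (2::real) powr - c"
  have t: "0 < t" "t < 1" using assms by (auto simp: t_def powr_less_one)
  let ?f = "\<lambda>k::int. (2::real) powr - (c * \<bar>real_of_int k\<bar>)"
  have f: "?f (int n) = t ^ n" "?f (- int n) = t ^ n" for n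
    by (auto simp: t_def powr_realpow[symmetric] powr_powr)
  have s: "(\<lambda>n. t ^ n) summable_on UNIV"
    using t by (intro norm_summable_imp_summable_on) (simp add: summable_geometric)
  have "?f summable_on range int"
    using s by (subst summable_on_reindex) (auto simp only: o_def f inj_of_nat)
  moreover have "?f summable_on range (\<lambda>n. - int n)"
    using s by (subst summable_on_reindex) (simp_all only: o_def f, simp add: inj_def)
  moreover have "range int \<union> range (\<lambda>n. - int n) = UNIV"
  proof -
    have "k \<in> range int \<union> range (\<lambda>n. - int n)" for k by (cases k rule: int_cases2) auto
    then show ?thesis by blast
  qed
  ultimately have sf: "?f summable_on UNIV" using summable_on_union by metis
  have "(\<Sum>\<^sub>\<infinity>k. ennreal (?f k)) = ennreal (infsum ?f UNIV)"
    by (subst infsum_nonneg_is_SUPREMUM_ennreal[OF sf]) (auto simp: nonneg_infsum_complete)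
  then show ?thesis
    using that[of "max 1 (infsum ?f UNIV)"] by (auto intro: ennreal_leI)
qed

section \<open>Tent functions and their vector gradients\<close>

lemma powi_eq_powr_two: "(2::real) powi k = 2 powr real_of_int k"
  by (simp add: powr_real_of_int')

text \<open>For \<open>k \<ge> 0\<close> the distance is less than \<open>1\<close>; then \<open>d / r\<close> is the relevant bound, and
  \<open>d = d powr S * d powr (1 - S)\<close> with \<open>d powr S \<le> d powr t\<close>. For \<open>k < 0\<close> the distance is at least
  \<open>1\<close>; then the bound \<open>1\<close> is used and \<open>d powr t \<ge> d powr s\<close> is large. The factor \<open>2\<close> compensates
  for the gap between \<open>2 powr (- k - 1)\<close> and \<open>2 powr (- k)\<close>, using \<open>s \<le> 1\<close>.\<close>

lemma min_one_ratio_le_dyadic_weight: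
  fixes d r t :: real and k :: int
  assumes d: "2 powi (- k - 1) \<le> d" "d < 2 powi (- k)"
    and t: "s \<le> t" "t \<le> S" "S \<le> 1" "0 < s" and \<sigma>: "0 \<le> \<sigma>" "\<sigma> \<le> s" "\<sigma> \<le> 1 - S"
    and r: "0 < r" "r \<le> 1"
  shows "min 1 (d / r) \<le> d powr t * (2 / r * 2 powr - (\<sigma> * \<bar>real_of_int k\<bar>))"
proof -
  have d': "2 powr (- real_of_int k - 1) \<le> d" "d < 2 powr (- real_of_int k)"
    using d by (simp_all add: powi_eq_powr_two)
  have "0 < d" by (rule less_le_trans[OF _ d'(1)]) simp
  show ?thesis
  proof (cases "0 \<le> k")
    case True
    have "d < 1"
      using d'(2) True powr_mono[of "- real_of_int k" 0 2] by simp
    have "d powr (1 - S) \<le> (2 powr - real_of_int k) powr (1 - S)"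
      using d' \<open>0 < d\<close> t by (intro powr_mono2) auto
    also have "\<dots> = 2 powr - ((1 - S) * k)" by (simp add: powr_powr mult.commute)
    also have "\<dots> \<le> 2 powr - (\<sigma> * \<bar>real_of_int k\<bar>)"
      using True \<sigma> by (simp add: mult_right_mono)
    finally have *: "d powr (1 - S) \<le> 2 powr - (\<sigma> * \<bar>real_of_int k\<bar>)" .
    have "d = d powr S * d powr (1 - S)"
      using \<open>0 < d\<close> by (simp add: powr_add[symmetric])
    also have "\<dots> \<le> d powr t * 2 powr - (\<sigma> * \<bar>real_of_int k\<bar>)"
      using * \<open>0 < d\<close> \<open>d < 1\<close> t by (intro mult_mono powr_mono') auto
    finally have "d / r \<le> d powr t * 2 powr - (\<sigma> * \<bar>real_of_int k\<bar>) / r"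
      using r by (simp add: divide_right_mono)
    also have "\<dots> \<le> 2 * (d powr t * 2 powr - (\<sigma> * \<bar>real_of_int k\<bar>) / r)"
    proof -
      have "0 \<le> d powr t * 2 powr - (\<sigma> * \<bar>real_of_int k\<bar>) / r" using r by simp
      then show ?thesis by linarith
    qed
    finally show ?thesis by (simp add: mult_ac)
  next
    case False
    then have k: "real_of_int k \<le> -1" "\<bar>real_of_int k\<bar> = - real_of_int k" by linarith+
    have "1 \<le> d"
      using d'(1) k powr_mono[of 0 "- real_of_int k - 1" 2] by simp
    have "(1::real) = 2 powr (s * (- real_of_int k - 1)) * 2 powr s * 2 powr (s * real_of_int k)"
      by (simp add: powr_add[symmetric] algebra_simps)
    also have "\<dots> \<le> d powr t * 2 * 2 powr - (\<sigma> * \<bar>real_of_int k\<bar>)"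
    proof (intro mult_mono)
      have "2 powr (s * (- real_of_int k - 1)) = (2 powr (- real_of_int k - 1)) powr s"
        by (simp add: powr_powr mult.commute)
      also have "\<dots> \<le> d powr s" using d' t by (intro powr_mono2) auto
      also have "\<dots> \<le> d powr t" using \<open>1 \<le> d\<close> t by (intro powr_mono) auto
      finally show "2 powr (s * (- real_of_int k - 1)) \<le> d powr t" .
      show "2 powr s \<le> (2::real)" using powr_mono[of s 1 2] t by simp
      show "2 powr (s * real_of_int k) \<le> 2 powr - (\<sigma> * \<bar>real_of_int k\<bar>)"
        using k \<sigma> by (auto intro: mult_right_mono_neg)
    qed auto
    also have "\<dots> \<le> d powr t * (2 / r * 2 powr - (\<sigma> * \<bar>real_of_int k\<bar>))"
    proof -
      have "2 \<le> 2 / r" using r by (simp add: field_simps)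
      then show ?thesis unfolding mult.assoc by (intro mult_left_mono mult_right_mono) auto
    qed
    finally show ?thesis by simp
  qed
qed

definition bump :: "real \<Rightarrow> 'a::metric_space \<Rightarrow> 'a \<Rightarrow> real" where
  "bump r c x = max 0 (1 - dist c x / r)"

lemma bump_bounds: "0 \<le> bump r c x" "0 < r \<Longrightarrow> bump r c x \<le> 1"
  by (auto simp: bump_def)

lemma bump_outside: "0 < r \<Longrightarrow> x \<notin> ball c r \<Longrightarrow> bump r c x = 0"
  by (auto simp: bump_def)

lemma bump_inside: "0 < r \<Longrightarrow> x \<in> ball c (r / 2) \<Longrightarrow> 1 / 2 \<le> bump r c x"
  by (auto simp: bump_def field_simps)

lemma bump_diff_le:
  assumes "0 < r"
  shows "\<bar>bump r c x - bump r c y\<bar> \<le> min 1 (dist x y / r)"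
proof -
  have "\<bar>dist c x - dist c y\<bar> \<le> dist x y" by metric
  then have "\<bar>dist c x / r - dist c y / r\<bar> \<le> dist x y / r"
    using assms by (simp add: diff_divide_distrib[symmetric] divide_right_mono)
  then have "\<bar>bump r c x - bump r c y\<bar> \<le> dist x y / r" unfolding bump_def by linarith
  then show ?thesis using bump_bounds[of r c] assms by (simp add: abs_le_iff) (smt (verit))
qed

lemma bump_measurable:
  assumes "sets M = sets borel" "0 < r"
  shows "(\<lambda>x. ereal (bump r c x)) \<in> borel_measurable M"
  unfolding bump_def by (subst measurable_cong_sets[OF assms(1) refl])
    (use assms(2) in \<open>intro borel_measurable_continuous_onI borel_measurable_ereal continuous_intros; simp\<close>)

lemma abs_fun_bump_le: "0 < r \<Longrightarrow> abs_fun (\<lambda>x. ereal (bump r c x)) x \<le> indicator (ball c r) x"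
  using bump_bounds[of r c x] bump_outside[of r x c]
  by (auto simp: abs_fun_def indicator_def)

definition bump_gradient :: "real \<Rightarrow> real \<Rightarrow> 'a::metric_space \<Rightarrow> int \<Rightarrow> 'a \<Rightarrow> ennreal" where
  "bump_gradient \<sigma> r c k x = ennreal (2 / r * 2 powr - (\<sigma> * \<bar>real_of_int k\<bar>)) * indicator (ball c r) x"

text \<open>The term of the gradient belonging to a single point of the ball already dominates the
  difference of the values. If neither point is in the ball, both values are \<open>0\<close>.\<close>

lemma bump_gradient_in_vector_gradients:
  assumes M: "sets M = sets borel" and s: "0 < s" "S \<le> 1"
    and AE: "AE x in M. s \<le> enn2real (e x) \<and> enn2real (e x) \<le> S"
    and \<sigma>: "0 \<le> \<sigma>" "\<sigma> \<le> s" "\<sigma> \<le> 1 - S" and r: "0 < r" "r \<le> 1"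
  shows "bump_gradient \<sigma> r c \<in> vector_gradients M e (\<lambda>x. ereal (bump r c x))"
proof -
  have space: "space M = UNIV" using sets_eq_imp_space_eq[OF M] by simp
  obtain N where N: "{x \<in> space M. \<not> (s \<le> enn2real (e x) \<and> enn2real (e x) \<le> S)} \<subseteq> N"
    "emeasure M N = 0" "N \<in> sets M"
    using AE_E[OF AE] .
  have ball: "ball c r \<in> sets M" by (simp add: M)
  have one_sided: "ennreal \<bar>bump r c x - bump r c y\<bar>
      \<le> ennreal (dist x y powr enn2real (e x)) * bump_gradient \<sigma> r c k x"
    if "x \<notin> N" "x \<in> ball c r" "2 powi (- k - 1) \<le> dist x y" "dist x y < 2 powi (- k)" for x y k
  proof -
    have "s \<le> enn2real (e x)" "enn2real (e x) \<le> S" using N(1) that(1) space by auto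
    from order.trans[OF bump_diff_le[OF r(1)]
        min_one_ratio_le_dyadic_weight[OF that(3,4) this s(2,1) \<sigma> r]]
    have "\<bar>bump r c x - bump r c y\<bar> \<le> dist x y powr enn2real (e x)
        * (2 / r * 2 powr - (\<sigma> * \<bar>real_of_int k\<bar>))" .
    then show ?thesis
      using that(2) r by (simp add: bump_gradient_def ennreal_mult[symmetric] ennreal_leI del: ennreal_mult'')
  qed
  have "e2ennreal \<bar>ereal (bump r c x) - ereal (bump r c y)\<bar>
      \<le> ennreal (dist x y powr enn2real (e x)) * bump_gradient \<sigma> r c k x
        + ennreal (dist x y powr enn2real (e y)) * bump_gradient \<sigma> r c k y"
    if "x \<notin> N" "y \<notin> N" "2 powi (- k - 1) \<le> dist x y" "dist x y < 2 powi (- k)" for x y k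
  proof -
    consider "x \<in> ball c r" | "y \<in> ball c r" | "x \<notin> ball c r" "y \<notin> ball c r" by blast
    then show ?thesis
    proof cases
      case 1
      then show ?thesis using one_sided[of x k y] that by (auto intro: add_increasing2)
    next
      case 2
      then show ?thesis using one_sided[of y k x] that
        by (auto intro: add_increasing simp: dist_commute abs_minus_commute)
    next
      case 3
      then have "bump r c x = 0" "bump r c y = 0" using bump_outside[OF r(1)] by blast+
      then show ?thesis by (simp add: zero_ennreal.abs_eq[symmetric])
    qed
  qed
  moreover have "bump_gradient \<sigma> r c k \<in> borel_measurable M" for k
    unfolding bump_gradient_def using ball by measurable
  ultimately show ?thesis
    unfolding vector_gradients_def using N(2,3) by (auto intro!: bexI[of _ N])
qed

text \<open>Only the measure of the supporting ball depends on the centre, so the uniform bound for the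
  measures of unit balls gives one constant \<open>K\<close> for all centres.\<close>

lemma bumps_bounded:
  fixes M :: "'a::metric_space measure"
  assumes M: "metric_measure_space M" and V: "(SUP x. emeasure M (ball x 1)) < \<infinity>"
    and e: "e \<in> bounded_exponents M" and p: "p \<in> bounded_exponents M" and q: "q \<in> exponents M"
    and cases: "esssup M e < 1 \<and> essinf M q < \<infinity> \<or> esssup M e \<le> 1 \<and> essinf M q = \<infinity>"
    and r: "0 < r" "r \<le> 1"
  shows "\<exists>K. \<forall>c. (\<lambda>x. ereal (bump r c x)) \<in> Lp_space M p
    \<and> M_norm M e p q (\<lambda>x. ereal (bump r c x)) \<le> ennreal K
    \<and> N_norm M e p q (\<lambda>x. ereal (bump r c x)) \<le> ennreal K"
proof -
  have sets: "sets M = sets borel" using M by (simp add: metric_measure_space_def)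
  obtain s where s: "0 < s" "AE x in M. s \<le> enn2real (e x)"
    using bounded_exponents_lower_bound[OF e] .
  obtain a where a: "0 < a" "AE x in M. a \<le> enn2real (p x)"
    using bounded_exponents_lower_bound[OF p] .
  define S where "S = enn2real (esssup M e)"
  have fin: "esssup M e < \<infinity>" using e by (simp add: bounded_exponents_def)
  have S: "S \<le> 1" using cases by (auto simp: S_def intro!: enn2real_leI)
  have AE: "AE x in M. s \<le> enn2real (e x) \<and> enn2real (e x) \<le> S"
    using s(2) esssup_AE[of e M]
    by eventually_elim (use fin in \<open>auto simp: S_def intro: enn2real_mono\<close>)
  define \<sigma> where "\<sigma> = min s (1 - S)"
  have \<sigma>: "0 \<le> \<sigma>" "\<sigma> \<le> s" "\<sigma> \<le> 1 - S" using s S by (auto simp: \<sigma>_def)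
  let ?w = "\<lambda>k::int. (2::real) powr - (\<sigma> * \<bar>real_of_int k\<bar>)"
  obtain b T :: real where b: "0 < b" "AE x in M. ennreal b \<le> q x" and T: "1 \<le> T"
    and sum: "(AE x in M. q x = \<infinity>) \<or> (\<Sum>\<^sub>\<infinity>k\<in>UNIV. ennreal (?w k powr b)) \<le> ennreal T"
  proof -
    obtain b where b: "0 < b" "AE x in M. ennreal b \<le> q x"
      using exponents_positive_lower_bound[OF q] .
    from cases show thesis
      \<comment> \<open>If \<open>s\<^sup>+ < 1\<close>, the weights decay geometrically. If \<open>q\<^sup>- = \<infinity>\<close>, then \<open>q = \<infinity>\<close> almost everywhere
        and any \<open>T \<ge> 1\<close> will do.\<close>
    proof
      assume *: "esssup M e < 1 \<and> essinf M q < \<infinity>"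
      then have "S < 1" using fin by (cases "esssup M e") (auto simp: S_def)
      then have "0 < \<sigma> * b" using s b by (simp add: \<sigma>_def)
      from two_sided_geometric_sum_finite[OF this] obtain T where
        "1 \<le> T" "(\<Sum>\<^sub>\<infinity>k\<in>UNIV. ennreal (2 powr - (\<sigma> * b * \<bar>real_of_int k\<bar>))) \<le> ennreal T" .
      then show thesis using that[of b T] b by (simp add: powr_powr mult_ac)
    next
      assume *: "esssup M e \<le> 1 \<and> essinf M q = \<infinity>"
      have "AE x in M. of_nat n \<le> q x" for n
        by (rule AE_ge_of_less_essinf) (use * in \<open>simp add: less_top[symmetric]\<close>)
      then have "AE x in M. \<forall>n. of_nat n \<le> q x" by (simp add: AE_all_countable)
      then have "AE x in M. q x = \<infinity>"
      proof eventually_elim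
        case (elim x)
        then show ?case by (metis ennreal_Ex_less_of_nat infinity_ennreal_def leD top.not_eq_extremum)
      qed
      then show thesis using that[of b 1] b by simp
    qed
  qed
  obtain \<delta> where \<delta>: "0 < \<delta>" "\<delta> \<le> 1" "ennreal (\<delta> powr a) * (SUP x. emeasure M (ball x 1)) \<le> 1"
    using exists_small_power_mult_le_1[OF V a(1)] .
  have ball: "ball c r \<in> sets M" for c by (simp add: sets)
  have small: "ennreal (\<delta> powr a) * emeasure M (ball c r) \<le> 1" for c
  proof -
    have "emeasure M (ball c r) \<le> emeasure M (ball c 1)"
      using r sets by (intro emeasure_mono) auto
    also have "\<dots> \<le> (SUP x. emeasure M (ball x 1))" by (rule SUP_upper) simp
    finally show ?thesis using \<delta>(3) by (meson mult_left_mono order.trans zero_le)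
  qed
  define D where "D = 2 / r * T powr (1 / b) / \<delta>"
  have w: "0 < ?w k" "0 \<le> ?w k" "?w k \<le> 1" for k
    using \<sigma> powr_mono[of "- (\<sigma> * \<bar>real_of_int k\<bar>)" 0 2] by auto
  have r2: "0 < 2 / r" using r by simp
  note grad = bump_gradient_in_vector_gradients[OF sets s(1) S AE \<sigma> r]
  let ?u = "\<lambda>c x. ereal (bump r c x)"
  have nM: "M_seminorm M e p q (?u c) \<le> ennreal D" for c
  proof -
    have "M_seminorm M e p q (?u c) \<le> Lp_lq_norm M p q (bump_gradient \<sigma> r c)"
      unfolding M_seminorm_def by (rule INF_lower[OF grad])
    also have "\<dots> \<le> ennreal D"
      unfolding bump_gradient_def D_def
      by (rule Lp_lq_norm_indicator_le[OF w(2,3) r2 T b sum \<delta>(1,2) a(2) ball small])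
    finally show ?thesis .
  qed
  have nN: "N_seminorm M e p q (?u c) \<le> ennreal D" for c
  proof -
    have "N_seminorm M e p q (?u c) \<le> lq_Lp_norm M p q (bump_gradient \<sigma> r c)"
      unfolding N_seminorm_def by (rule INF_lower[OF grad])
    also have "\<dots> \<le> ennreal D"
      unfolding bump_gradient_def D_def
      by (rule lq_Lp_norm_indicator_le[OF w(1,3) r2 T b sum \<delta>(1,2) a(2) ball small])
    finally show ?thesis .
  qed
  have nL: "Lp_norm M p (abs_fun (?u c)) \<le> ennreal (1 / \<delta>)" for c
    by (rule Lp_norm_indicator_le[OF _ _ \<delta>(1,2) a(2) ball small])
      (use abs_fun_bump_le[OF r(1)] in auto)
  have D: "0 \<le> D" using r T \<delta> by (simp add: D_def)
  show ?thesis
  proof (intro exI[of _ "1 / \<delta> + D"] allI conjI)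
    fix c
    have "modular M p (\<lambda>x. ennreal \<delta> * abs_fun (?u c) x)
        \<le> ennreal (\<delta> powr a) * emeasure M (ball c r)"
      using \<delta> abs_fun_bump_le[OF r(1)]
      by (intro modular_indicator_le[OF _ _ \<delta>(2) a(2) ball]) (auto intro!: AE_I2 mult_left_mono)
    also have "\<dots> < \<infinity>" using small[of c] by (auto intro: le_less_trans)
    finally show "?u c \<in> Lp_space M p"
      unfolding Lp_space_def using bump_measurable[OF sets r(1)] \<delta>(1) by auto
    show "M_norm M e p q (?u c) \<le> ennreal (1 / \<delta> + D)"
      unfolding M_norm_def using \<delta>(1) D add_mono[OF nL nM] by (simp add: ennreal_plus)
    show "N_norm M e p q (?u c) \<le> ennreal (1 / \<delta> + D)"
      unfolding N_norm_def using \<delta>(1) D add_mono[OF nL nN] by (simp add: ennreal_plus)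
  qed
qed

section \<open>Separation of tents and compactness\<close>

lemma Lp_norm_less_imp_modular_le:
  assumes "Lp_norm M p f < ennreal e"
  shows "modular M p (\<lambda>x. f x / ennreal e) \<le> 1"
proof -
  obtain l :: real where l: "0 < l" "modular M p (\<lambda>x. f x / ennreal l) \<le> 1" "ennreal l < ennreal e"
    using assms unfolding Lp_norm_def INF_less_iff by auto
  have "modular M p (\<lambda>x. f x / ennreal e) \<le> modular M p (\<lambda>x. f x / ennreal l)"
    unfolding modular_def divide_ennreal_def using l
    by (intro nn_integral_mono enn_powr_mono mult_left_mono)
      (auto simp: inverse_ennreal ennreal_less_iff intro!: ennreal_leI)
  with l(2) show ?thesis by simp
qed

text \<open>At each point of \<open>A\<close> one of \<open>\<bar>u - w\<bar>\<close>, \<open>\<bar>v - w\<bar>\<close> is at least \<open>1/4\<close>, hence one of the two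
  integrands of the modulars at scale \<open>e\<close> is at least \<open>(1 / (4 e)) powr a\<close>; both modulars are at
  most \<open>1\<close>. Arguing with the modulars directly takes the place of a quasi-triangle inequality in
  the variable exponent space.\<close>

lemma measure_le_of_near_common_function:
  fixes u v w :: "'a \<Rightarrow> ereal"
  assumes meas: "u \<in> borel_measurable M" "v \<in> borel_measurable M" "w \<in> borel_measurable M"
      "p \<in> borel_measurable M"
    and A: "A \<in> sets M" and gap: "\<And>x. x \<in> A \<Longrightarrow> ereal (1 / 2) \<le> u x" "\<And>x. x \<in> A \<Longrightarrow> v x = 0"
    and p: "AE x in M. a \<le> enn2real (p x)" and e: "0 < e" "4 * e \<le> 1"
    and near: "Lp_norm M p (abs_fun (\<lambda>x. u x - w x)) < ennreal e"
      "Lp_norm M p (abs_fun (\<lambda>x. v x - w x)) < ennreal e"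
  shows "ennreal ((1 / (4 * e)) powr a) * emeasure M A \<le> 2"
proof -
  let ?f = "\<lambda>x. enn_powr (abs_fun (\<lambda>x. u x - w x) x / ennreal e) (p x)"
  let ?g = "\<lambda>x. enn_powr (abs_fun (\<lambda>x. v x - w x) x / ennreal e) (p x)"
  have [measurable]: "?f \<in> borel_measurable M" "?g \<in> borel_measurable M"
    using meas unfolding enn_powr_def abs_fun_def by measurable
  have far: "ennreal ((1 / (4 * e)) powr a) \<le> enn_powr (abs_fun h x / ennreal e) (p x)"
    if "ereal (1 / 4) \<le> \<bar>h x\<bar>" "a \<le> enn2real (p x)" for h x
  proof -
    have "ennreal ((1 / (4 * e)) powr a) \<le> ennreal ((1 / (4 * e)) powr enn2real (p x))"
      using e that(2) by (intro ennreal_leI powr_mono) (auto simp: field_simps)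
    also have "\<dots> = enn_powr (ennreal (1 / 4) / ennreal e) (p x)"
      using e by (simp add: divide_ennreal)
    also have "\<dots> \<le> enn_powr (abs_fun h x / ennreal e) (p x)"
    proof (intro enn_powr_mono divide_right_mono_ennreal)
      have "ennreal (1 / 4) = e2ennreal (ereal (1 / 4))" by simp
      also have "\<dots> \<le> abs_fun h x"
        unfolding abs_fun_def using that(1) by (intro e2ennreal_mono) simp
      finally show "ennreal (1 / 4) \<le> abs_fun h x" .
    qed
    finally show ?thesis .
  qed
  have "ennreal ((1 / (4 * e)) powr a) * emeasure M A
      = (\<integral>\<^sup>+ x. ennreal ((1 / (4 * e)) powr a) * indicator A x \<partial>M)"
    using A by (simp add: nn_integral_cmult_indicator)
  also have "\<dots> \<le> (\<integral>\<^sup>+ x. ?f x + ?g x \<partial>M)"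
  proof (rule nn_integral_mono_AE)
    show "AE x in M. ennreal ((1 / (4 * e)) powr a) * indicator A x \<le> ?f x + ?g x"
      using p
    proof eventually_elim
      case (elim x)
      show ?case
      proof (cases "x \<in> A")
        case True
        have "ereal (1 / 4) \<le> \<bar>u x - w x\<bar> \<or> ereal (1 / 4) \<le> \<bar>v x - w x\<bar>"
          using gap[OF True] by (cases "u x"; cases "w x") auto
        then show ?thesis
          using True far[of "\<lambda>x. u x - w x" x] far[of "\<lambda>x. v x - w x" x] elim
          by (auto intro: add_increasing add_increasing2)
      qed simp
    qed
  qed
  also have "\<dots> = (\<integral>\<^sup>+ x. ?f x \<partial>M) + (\<integral>\<^sup>+ x. ?g x \<partial>M)"
    by (rule nn_integral_add) measurable
  also have "\<dots> \<le> 1 + 1"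
    using near[THEN Lp_norm_less_imp_modular_le] unfolding modular_def by (rule add_mono)
  finally show ?thesis by simp
qed

text \<open>Two tents within \<open>e\<close> of the same function must have centres at distance less than \<open>2 r\<close>: by
  the choice of \<open>e\<close> the previous lemma would otherwise fail on \<open>B(z,r/2)\<close>. Thus each function of a
  finite \<open>e\<close>-net for the family of tents accounts for the centres in one ball of radius \<open>2 r\<close>.\<close>

lemma covered_by_balls_of_compact_embedding:
  fixes M :: "'a::metric_space measure"
  assumes M: "metric_measure_space M" and b: "b \<in> bounded_exponents M" and r: "0 < r"
    and h: "(INF x. emeasure M (ball x (r / 2))) > 0"
    and emb: "compact_embedding Y nY (Lp_space M b) (\<lambda>u. Lp_norm M b (abs_fun u))"
    and Y: "\<And>c. (\<lambda>x. ereal (bump r c x)) \<in> Y" "\<And>c. nY (\<lambda>x. ereal (bump r c x)) \<le> ennreal K"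
  shows "\<exists>P. finite P \<and> (UNIV :: 'a set) \<subseteq> (\<Union>x\<in>P. ball x (2 * r))"
proof -
  have sets: "sets M = sets borel" using M by (simp add: metric_measure_space_def)
  obtain a where a: "0 < a" "AE x in M. a \<le> enn2real (b x)"
    using bounded_exponents_lower_bound[OF b] .
  let ?u = "\<lambda>c x. ereal (bump r c x)"
  let ?n = "\<lambda>u. Lp_norm M b (abs_fun u)"
  obtain e where e: "0 < e" "4 * e \<le> 1"
    "2 < ennreal ((1 / (4 * e)) powr a) * (INF x. emeasure M (ball x (r / 2)))"
  proof -
    \<comment> \<open>With \<open>e = 1 / (4 Q)\<close> the first factor becomes \<open>Q powr a\<close>, so \<open>Q powr a \<ge> 3 / l\<close> is needed, and
      \<open>Q \<ge> 1\<close> ensures \<open>4 e \<le> 1\<close>.\<close>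
    obtain m where m: "0 < m" "m < (INF x. emeasure M (ball x (r / 2)))" using dense[OF h] by blast
    then obtain l :: real where l: "0 < l" "m = ennreal l" by (cases m) auto
    define Q where "Q = max 1 ((3 / l) powr (1 / a))"
    have "3 / l = ((3 / l) powr (1 / a)) powr a" using l a by (simp add: powr_powr)
    also have "\<dots> \<le> Q powr a" using a by (intro powr_mono2) (auto simp: Q_def)
    finally have "3 \<le> Q powr a * l" using l by (simp add: field_simps)
    then have "(2::ennreal) < ennreal (Q powr a * l)"
      by (simp add: ennreal_less_iff flip: ennreal_numeral)
    also have "\<dots> \<le> ennreal (Q powr a) * (INF x. emeasure M (ball x (r / 2)))"
      using m l by (simp add: ennreal_mult mult_left_mono)
    finally show thesis using that[of "1 / (4 * Q)"] by (auto simp: Q_def)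
  qed
  have "range ?u \<subseteq> Y" "\<exists>C<\<infinity>. \<forall>u\<in>range ?u. nY u \<le> C"
    using Y by (auto intro!: exI[of _ "ennreal K"])
  then obtain F where F: "F \<subseteq> Lp_space M b" "finite F"
      "\<forall>u\<in>range ?u. \<exists>v\<in>F. ?n (\<lambda>x. u x - v x) < ennreal e"
  proof -
    have "\<forall>e>0. \<exists>F\<subseteq>Lp_space M b. finite F \<and> (\<forall>u\<in>range ?u. \<exists>v\<in>F. ?n (\<lambda>x. u x - v x) < e)"
      using emb \<open>range ?u \<subseteq> Y\<close> \<open>\<exists>C<\<infinity>. \<forall>u\<in>range ?u. nY u \<le> C\<close>
      unfolding compact_embedding_def by blast
    then have "\<exists>F\<subseteq>Lp_space M b. finite F \<and> (\<forall>u\<in>range ?u. \<exists>v\<in>F. ?n (\<lambda>x. u x - v x) < ennreal e)"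
      using e(1) by (elim allE[of _ "ennreal e"] impE) simp_all
    then show thesis by (elim exE conjE) (rule that)
  qed
  define centre where "centre v = (SOME c. ?n (\<lambda>x. ?u c x - v x) < ennreal e)" for v
  have "z \<in> (\<Union>c\<in>centre ` F. ball c (2 * r))" for z
  proof -
    obtain v where v: "v \<in> F" "?n (\<lambda>x. ?u z x - v x) < ennreal e" using F(3) by auto
    have c: "?n (\<lambda>x. ?u (centre v) x - v x) < ennreal e"
      unfolding centre_def
      by (rule someI[where P = "\<lambda>c. ?n (\<lambda>x. ?u c x - v x) < ennreal e", OF v(2)])
    have "dist (centre v) z < 2 * r"
    proof (rule ccontr)
      assume far: "\<not> dist (centre v) z < 2 * r"
      have "ennreal ((1 / (4 * e)) powr a) * emeasure M (ball z (r / 2)) \<le> 2"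
      proof (rule measure_le_of_near_common_function[where u = "?u z" and v = "?u (centre v)" and w = v])
        show "v \<in> borel_measurable M" using v F by (auto simp: Lp_space_def)
        show "b \<in> borel_measurable M"
          using b by (auto simp: bounded_exponents_def exponents_def)
        show "ereal (1 / 2) \<le> ?u z x" if "x \<in> ball z (r / 2)" for x
          using bump_inside[OF r that] by simp
        show "?u (centre v) x = 0" if "x \<in> ball z (r / 2)" for x
        proof -
          have "dist (centre v) z \<le> dist (centre v) x + dist z x" by metric
          then have "x \<notin> ball (centre v) r" using that far r by simp
          then show ?thesis using bump_outside[OF r] by simp
        qed
      qed (rule bump_measurable[OF sets r] a(2) e(1,2) v(2) c | simp add: sets)+
      moreover have "(INF x. emeasure M (ball x (r / 2))) \<le> emeasure M (ball z (r / 2))"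
        by (rule INF_lower) simp
      ultimately have "ennreal ((1 / (4 * e)) powr a) * (INF x. emeasure M (ball x (r / 2))) \<le> 2"
        by (rule order.trans[OF mult_left_mono[OF _ zero_le], rotated])
      with e(3) show False by (rule leD[THEN notE, rotated])
    qed
    then show ?thesis using v by auto
  qed
  then show ?thesis using F(2) by (intro exI[of _ "centre ` F"]) auto
qed

theorem theorem3p4:
  fixes M :: "'a::metric_space measure"
  assumes "metric_measure_space M"
    and "(SUP x. emeasure M (ball x 1)) < \<infinity>"
    and "\<forall>r::real. 0 < r \<and> r < 1 \<longrightarrow> (INF x. emeasure M (ball x r)) > 0"
    and "\<exists>s \<in> bounded_exponents M. \<exists>p \<in> bounded_exponents M. \<exists>b \<in> bounded_exponents M.
         \<exists>q \<in> exponents M.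
           (esssup M s < 1 \<and> essinf M q < \<infinity> \<or> esssup M s \<le> 1 \<and> essinf M q = \<infinity>) \<and>
           (compact_embedding (M_space M s p q) (M_norm M s p q)
              (Lp_space M b) (\<lambda>u. Lp_norm M b (abs_fun u)) \<or>
            compact_embedding (N_space M s p q) (N_norm M s p q)
              (Lp_space M b) (\<lambda>u. Lp_norm M b (abs_fun u)))"
  shows "totally_bounded (UNIV :: 'a set)"
  unfolding totally_bounded_metric
proof (intro allI impI)
  fix \<epsilon> :: real assume \<epsilon>: "0 < \<epsilon>"
  obtain s p b q where spb: "s \<in> bounded_exponents M" "p \<in> bounded_exponents M"
      "b \<in> bounded_exponents M" and q: "q \<in> exponents M"
    and cases: "esssup M s < 1 \<and> essinf M q < \<infinity> \<or> esssup M s \<le> 1 \<and> essinf M q = \<infinity>"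
    and emb: "compact_embedding (M_space M s p q) (M_norm M s p q)
        (Lp_space M b) (\<lambda>u. Lp_norm M b (abs_fun u)) \<or>
      compact_embedding (N_space M s p q) (N_norm M s p q)
        (Lp_space M b) (\<lambda>u. Lp_norm M b (abs_fun u))"
    using assms(4) by (elim bexE conjE) (rule that)
  define r where "r = min 1 (\<epsilon> / 2)"
  have r: "0 < r" "r \<le> 1" "2 * r \<le> \<epsilon>" using \<epsilon> by (auto simp: r_def)
  obtain K :: real where "\<forall>c. (\<lambda>x. ereal (bump r c x)) \<in> Lp_space M p
      \<and> M_norm M s p q (\<lambda>x. ereal (bump r c x)) \<le> ennreal K
      \<and> N_norm M s p q (\<lambda>x. ereal (bump r c x)) \<le> ennreal K"
    using bumps_bounded[OF assms(1,2) spb(1,2) q cases r(1,2)] ..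
  then have K: "(\<lambda>x. ereal (bump r c x)) \<in> Lp_space M p"
    "M_norm M s p q (\<lambda>x. ereal (bump r c x)) \<le> ennreal K"
    "N_norm M s p q (\<lambda>x. ereal (bump r c x)) \<le> ennreal K" for c by simp_all
  have h: "(INF x. emeasure M (ball x (r / 2))) > 0" using assms(3)[rule_format, of "r / 2"] r by simp
  note cover = covered_by_balls_of_compact_embedding[OF assms(1) spb(3) r(1) h]
  have spaces: "(\<lambda>x. ereal (bump r c x)) \<in> M_space M s p q" "(\<lambda>x. ereal (bump r c x)) \<in> N_space M s p q" for c
  proof -
    have "M_norm M s p q (\<lambda>x. ereal (bump r c x)) < \<infinity>" "N_norm M s p q (\<lambda>x. ereal (bump r c x)) < \<infinity>"
      using K(2,3)[of c] by (auto intro: le_less_trans[OF _ ennreal_less_top])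
    then show "(\<lambda>x. ereal (bump r c x)) \<in> M_space M s p q" "(\<lambda>x. ereal (bump r c x)) \<in> N_space M s p q"
      using K(1) by (auto simp: M_space_def N_space_def M_norm_def N_norm_def)
  qed
  from emb have "\<exists>P. finite P \<and> (UNIV :: 'a set) \<subseteq> (\<Union>x\<in>P. ball x (2 * r))"
  proof
    assume "compact_embedding (M_space M s p q) (M_norm M s p q)
        (Lp_space M b) (\<lambda>u. Lp_norm M b (abs_fun u))"
    from cover[OF this, of K] spaces(1) K(2) show ?thesis by simp
  next
    assume "compact_embedding (N_space M s p q) (N_norm M s p q)
        (Lp_space M b) (\<lambda>u. Lp_norm M b (abs_fun u))"
    from cover[OF this, of K] spaces(2) K(3) show ?thesis by simp
  qed
  then obtain P where P: "finite P" "(UNIV :: 'a set) \<subseteq> (\<Union>x\<in>P. ball x (2 * r))" by blast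
  have "(\<Union>x\<in>P. ball x (2 * r)) \<subseteq> (\<Union>x\<in>P. ball x \<epsilon>)"
    by (rule UN_mono[OF order.refl subset_ball[OF r(3)]])
  with P show "\<exists>k. finite k \<and> (UNIV :: 'a set) \<subseteq> (\<Union>x\<in>k. {y. dist x y < \<epsilon>})"
    unfolding ball_def by blast
qed

end
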